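(* Let $X$ be an infinite dimensional Banach space and let $f,g:X\to X$ be Matkowski contractions such that both $f$ and $g$ are compact (i.e., the closures of $f(D)$ and $g(D)$ are compact for every bounded $D\subset X$; $f,g$ need not be linear). Then: (i) $C_{f,g}$ is strongly porous (in particular, nowhere dense); (ii) $C_{f,g}$ is a countable union of compact sets, and in particular, it is $\sigma$-c-porous.
   Context: A map $h:X\to X$ on a metric space $(X,d)$ is a Matkowski contraction if there is a nondecreasing function $\varphi:[0,\infty)\to\mathbb R$ with $\varphi^{(n)}(t)\to 0$ as $n\to\infty$ for every $t\ge 0$ ($\varphi^{(n)}$ is the $n$-th iterate) such that $d(h(x),h(y))\le\varphi(d(x,y))$ for all $x,y\in X$. (The inequality with $x=y$ and monotonicity force $\varphi\ge 0$, so the iterates make sense.) For a complete metric space $X$ and a finite family $\mathcal F$ of Matkowski contractions of $X$ (an iterated function system, IFS), the attractor $A_{\mathcal F}$ is the unique nonempty compact set $A\subset X$ with $A=\bigcup_{h\in\mathcal F}h(A)$ (it exists and is unique). For a Banach space $X$, Matkowski contractions $f,g:X\to X$ and $w\in X$, put $g_w(x):=g(x)+w$ and $\mathcal F_w:=\{f,g_w\}$. Define $C_{f,g}:=\{w\in X: A_{\mathcal F_w}\text{ is connected}\}$. A subset $M$ of a Banach space $X$ is strongly porous if for all $R>0$, all $x\in X$ and all $\alpha\in(0,1)$ there is $y\in X$ with $\|x-y\|=R$ and $B(y,\alpha R)\cap M=\emptyset$, where $B(y,r)$ is the open ball. $M$ is c-porous if its convex hull is nowhere dense; $M$ is $\sigma$-c-porous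 if it is a countable union of c-porous sets. *)

theory Defs
  imports "HOL-Analysis.Analysis"
begin

(* phi is only relevant on {0..}. The contraction inequality at x = y together with monotonicity
   makes phi nonnegative there, so its iterates at t >= 0 never leave {0..} and do not depend on
   the values of the total function phi at negative arguments. *)
definition matkowski_contraction :: "('a::metric_space \<Rightarrow> 'a) \<Rightarrow> bool" where
  "matkowski_contraction h \<longleftrightarrow>
     (\<exists>\<phi> :: real \<Rightarrow> real.
        mono_on {0..} \<phi> \<and>
        (\<forall>t\<ge>0. (\<lambda>n. (\<phi> ^^ n) t) \<longlonglongrightarrow> 0) \<and>
        (\<forall>x y. dist (h x) (h y) \<le> \<phi> (dist x y)))"

definition is_attractor :: "('a::topological_space \<Rightarrow> 'a) set \<Rightarrow> 'a set \<Rightarrow> bool" where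
  "is_attractor F A \<longleftrightarrow> A \<noteq> {} \<and> compact A \<and> A = (\<Union>h\<in>F. h ` A)"

(* Meaningful when F is a finite nonempty family of Matkowski contractions of a complete metric
   space: then exactly one set satisfies is_attractor F. *)
definition attractor :: "('a::topological_space \<Rightarrow> 'a) set \<Rightarrow> 'a set" where
  "attractor F = (THE A. is_attractor F A)"

definition connectedness_locus ::
    "('a::real_normed_vector \<Rightarrow> 'a) \<Rightarrow> ('a \<Rightarrow> 'a) \<Rightarrow> 'a set" where
  "connectedness_locus f g = {w. connected (attractor {f, \<lambda>x. g x + w})}"

(* Not assumed linear. *)
definition compact_map :: "('a::metric_space \<Rightarrow> 'b::topological_space) \<Rightarrow> bool" where
  "compact_map f \<longleftrightarrow> (\<forall>D. bounded D \<longrightarrow> compact (closure (f ` D)))"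

definition nowhere_dense :: "'a::topological_space set \<Rightarrow> bool" where
  "nowhere_dense M \<longleftrightarrow> interior (closure M) = {}"

definition strongly_porous :: "'a::real_normed_vector set \<Rightarrow> bool" where
  "strongly_porous M \<longleftrightarrow>
     (\<forall>R>0. \<forall>x. \<forall>\<alpha>\<in>{0<..<1}. \<exists>y. norm (x - y) = R \<and> ball y (\<alpha> * R) \<inter> M = {})"

definition c_porous :: "'a::real_normed_vector set \<Rightarrow> bool" where
  "c_porous M \<longleftrightarrow> nowhere_dense (convex hull M)"

definition sigma_c_porous :: "'a::real_normed_vector set \<Rightarrow> bool" where
  "sigma_c_porous M \<longleftrightarrow> (\<exists>\<P>. countable \<P> \<and> (\<forall>P\<in>\<P>. c_porous P) \<and> M = \<Union>\<P>)"

definition sigma_compact :: "'a::topological_space set \<Rightarrow> bool" where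
  "sigma_compact M \<longleftrightarrow> (\<exists>\<K>. countable \<K> \<and> (\<forall>K\<in>\<K>. compact K) \<and> M = \<Union>\<K>)"

end

theory Submission
  imports Defs
begin

text \<open>A connected attractor \<open>A\<close> of \<open>{f, g + w}\<close> cannot be the disjoint union of the compact
  sets \<open>f A\<close> and \<open>g A + w\<close>, so \<open>w\<close> lies in \<open>f A - g A\<close>. For \<open>w\<close> in a fixed ball all attractors
  lie in one ball, because a Matkowski contraction of a normed space grows at most like
  \<open>c * norm x\<close> with \<open>c < 1\<close>; hence this part of the connectedness locus is relatively compact, as
  \<open>f\<close> and \<open>g\<close> are compact maps. The locus is closed, because any limit of attractors is
  again an attractor and connectedness survives in the limit. Finally, the convex hull of a compact
  set lies within \<open>\<epsilon>\<close> of a finite-dimensional subspace, from which Riesz's lemma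
  moves away at almost full speed.\<close>

section \<open>Closedness of finite-dimensional subspaces and Riesz's lemma\<close>

text \<open>A vector \<open>v\<close> outside the closed span has positive distance \<open>d\<close>
  from it, so the coefficient of \<open>v\<close> is bounded by the norm of the whole vector divided
  by \<open>d\<close>. Along a convergent sequence the coefficients are therefore Cauchy, and the
  limit splits in the same way as its approximants.\<close>

lemma closed_span_insert:
  fixes V :: "'a::real_normed_vector set"
  assumes "closed (span V)"
  shows "closed (span (insert v V))"
proof (cases "v \<in> span V")
  case True
  then show ?thesis using assms by (simp add: span_redundant)
next
  case False
  define d where "d = infdist v (span V)"
  have ne: "span V \<noteq> {}" using span_zero by blast
  have d: "d > 0"
    unfolding d_def using infdist_pos_not_in_closed[OF assms ne False] .
  have key: "\<bar>k\<bar> * d \<le> norm (u + k *\<^sub>R v)" if "u \<in> span V" for u k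
  proof (cases "k = 0")
    case False
    have "- (1 / k) *\<^sub>R u \<in> span V" using that by (rule span_scale)
    then have "d \<le> dist v (- (1 / k) *\<^sub>R u)" unfolding d_def by (rule infdist_le)
    then have "\<bar>k\<bar> * d \<le> \<bar>k\<bar> * norm (v + (1 / k) *\<^sub>R u)"
      by (simp add: dist_norm mult_left_mono)
    also have "\<dots> = norm (k *\<^sub>R (v + (1 / k) *\<^sub>R u))" by simp
    also have "k *\<^sub>R (v + (1 / k) *\<^sub>R u) = u + k *\<^sub>R v"
      using False by (simp add: scaleR_add_right add.commute)
    finally show ?thesis .
  qed simp
  show ?thesis
    unfolding closed_sequential_limits
  proof (intro allI impI, elim conjE)
    fix z l assume z: "\<forall>n. z n \<in> span (insert v V)" and l: "z \<longlonglongrightarrow> l"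
    have "\<forall>n. \<exists>k. z n - k *\<^sub>R v \<in> span V"
      using z by (simp add: span_breakdown_eq)
    then obtain k where k: "\<And>n. z n - k n *\<^sub>R v \<in> span V" by metis
    have diff: "\<bar>k m - k n\<bar> * d \<le> norm (z m - z n)" for m n
      using key[OF span_diff[OF k[of m] k[of n]], of "k m - k n"]
      by (simp add: algebra_simps)
    have "Cauchy k"
    proof (rule metric_CauchyI)
      fix e :: real assume "e > 0"
      then obtain M where M: "\<And>m n. m \<ge> M \<Longrightarrow> n \<ge> M \<Longrightarrow> norm (z m - z n) < e * d"
        using LIMSEQ_imp_Cauchy[OF l] d unfolding Cauchy_iff by (meson mult_pos_pos)
      have "dist (k m) (k n) < e" if "m \<ge> M" "n \<ge> M" for m n
        using order_le_less_trans[OF diff[of m n] M[OF that]] d by (simp add: dist_real_def)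
      then show "\<exists>M. \<forall>m\<ge>M. \<forall>n\<ge>M. dist (k m) (k n) < e" by blast
    qed
    then obtain c where "k \<longlonglongrightarrow> c" using Cauchy_convergent convergent_def by blast
    then have "(\<lambda>n. z n - k n *\<^sub>R v) \<longlonglongrightarrow> l - c *\<^sub>R v" using l by (intro tendsto_intros)
    then have "l - c *\<^sub>R v \<in> span V" by (rule closed_sequentially[OF assms k])
    then show "l \<in> span (insert v V)" by (auto simp: span_breakdown_eq)
  qed
qed

lemma closed_span_finite:
  fixes B :: "'a::real_normed_vector set"
  assumes "finite B"
  shows "closed (span B)"
  using assms by induction (simp_all add: closed_span_insert)

text \<open>The unit vector is the normalised \<open>z - v0\<close>, where \<open>v0\<close> in
  \<open>V\<close> is nearest to \<open>z\<close> up to the factor \<open>1 / \<theta>\<close>; an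
  exact nearest point need not exist.\<close>

lemma riesz_lemma:
  fixes V :: "'a::real_normed_vector set"
  assumes "subspace V" "closed V" "V \<noteq> UNIV" and "0 < \<theta>" "\<theta> < 1"
  obtains u where "norm u = 1" "\<And>v. v \<in> V \<Longrightarrow> \<theta> \<le> norm (u - v)"
proof -
  obtain z where z: "z \<notin> V" using assms by blast
  have ne: "V \<noteq> {}" using assms subspace_0 by blast
  define d where "d = infdist z V"
  have d: "d > 0" unfolding d_def using infdist_pos_not_in_closed[OF assms(2) ne z] .
  have "infdist z V < d / \<theta>" using d assms by (simp add: d_def[symmetric] field_simps)
  then obtain v0 where v0: "v0 \<in> V" "dist z v0 < d / \<theta>"
    using ne by (auto simp: infdist_def cINF_less_iff)
  define s where "s = norm (z - v0)"
  have s: "s > 0" using z v0 by (auto simp: s_def)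
  have "\<theta> \<le> norm ((1 / s) *\<^sub>R (z - v0) - v)" if "v \<in> V" for v
  proof -
    have "v0 + s *\<^sub>R v \<in> V" using assms(1) v0 that by (simp add: subspace_add subspace_scale)
    then have "d \<le> norm (z - (v0 + s *\<^sub>R v))" unfolding d_def dist_norm[symmetric] by (rule infdist_le)
    also have "z - (v0 + s *\<^sub>R v) = s *\<^sub>R ((1 / s) *\<^sub>R (z - v0) - v)"
      using s by (simp add: scaleR_diff_right algebra_simps)
    finally have "d \<le> s * norm ((1 / s) *\<^sub>R (z - v0) - v)" using s by simp
    moreover have "\<theta> * s < d" using v0 assms by (simp add: s_def dist_norm field_simps)
    ultimately have "s * \<theta> < s * norm ((1 / s) *\<^sub>R (z - v0) - v)" by (simp add: mult.commute)
    then show ?thesis using s by simp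
  qed
  moreover have "norm ((1 / s) *\<^sub>R (z - v0)) = 1" using s by (simp add: s_def)
  ultimately show thesis using that by blast
qed

section \<open>Porosity of compact and locally compact sets in infinite dimension\<close>

lemma strongly_porous_convex_hull_compact:
  fixes K :: "'a::real_normed_vector set"
  assumes infinite_dim: "\<not> (\<exists>B::'a set. finite B \<and> span B = UNIV)" and "compact K"
  shows "strongly_porous (convex hull K)"
  unfolding strongly_porous_def
proof (intro allI impI ballI)
  fix R \<alpha> :: real and x :: 'a assume R: "R > 0" and \<alpha>: "\<alpha> \<in> {0<..<1}"
  \<comment> \<open>With Riesz constant \<open>(1 + \<alpha>) / 2\<close>, midway between
    \<open>\<alpha>\<close> and 1, a step of length \<open>R\<close> gains the distance
    \<open>R * (1 + \<alpha>) / 2\<close>, which is exactly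
    \<open>\<alpha> * R + \<epsilon>\<close>.\<close>
  define \<epsilon> where "\<epsilon> = R * (1 - \<alpha>) / 2"
  have \<epsilon>: "\<epsilon> > 0" using R \<alpha> by (simp add: \<epsilon>_def)
  have sc: "seq_compact K" using assms(2) by (simp add: compact_eq_seq_compact_metric)
  obtain k where k: "finite k" "K \<subseteq> (\<Union>p\<in>k. ball p \<epsilon>)"
    using seq_compact_imp_totally_bounded[OF sc] \<epsilon> by blast
  \<comment> \<open>Including \<open>x\<close> puts the starting point in \<open>V\<close>, so the
    distance of \<open>x + R u\<close> from \<open>V\<close> equals that of
    \<open>R u\<close>.\<close>
  define V where "V = span (insert x k)"
  have "closed V" "V \<noteq> UNIV"
    using infinite_dim k(1) by (auto simp: V_def intro!: closed_span_finite)
  then obtain u where u: "norm u = 1" "\<And>v. v \<in> V \<Longrightarrow> (1 + \<alpha>) / 2 \<le> norm (u - v)"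
    using riesz_lemma[of V "(1 + \<alpha>) / 2"] \<alpha> by (auto simp: V_def)
  \<comment> \<open>The \<open>\<epsilon>\<close>-neighbourhood of a subspace is a sum of two convex
    sets, so it contains the hull as soon as it contains \<open>K\<close>.\<close>
  have hull: "convex hull K \<subseteq> (\<Union>p\<in>V. \<Union>q\<in>ball 0 \<epsilon>. {p + q})"
  proof (rule hull_minimal)
    show "K \<subseteq> (\<Union>p\<in>V. \<Union>q\<in>ball 0 \<epsilon>. {p + q})"
    proof
      fix y assume "y \<in> K"
      then obtain p where "p \<in> k" "y \<in> ball p \<epsilon>" using k by blast
      then show "y \<in> (\<Union>p\<in>V. \<Union>q\<in>ball 0 \<epsilon>. {p + q})"
        by (intro UN_I[of p] UN_I[of "y - p"]) (auto simp: V_def dist_norm norm_minus_commute intro: span_base)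
    qed
    show "convex (\<Union>p\<in>V. \<Union>q\<in>ball 0 \<epsilon>. {p + q})"
      by (intro convex_sums convex_ball) (simp add: V_def subspace_imp_convex)
  qed
  have "ball (x + R *\<^sub>R u) (\<alpha> * R) \<inter> convex hull K = {}"
  proof (rule ccontr)
    assume "ball (x + R *\<^sub>R u) (\<alpha> * R) \<inter> convex hull K \<noteq> {}"
    then obtain y where "y \<in> ball (x + R *\<^sub>R u) (\<alpha> * R)" "y \<in> convex hull K" by blast
    then obtain p q where pq: "p \<in> V" "norm q < \<epsilon>" "dist (x + R *\<^sub>R u) (p + q) < \<alpha> * R"
      using hull by auto
    have "x \<in> V" by (simp add: V_def span_base)
    then have "(1 / R) *\<^sub>R (p - x) \<in> V"
      using pq(1) unfolding V_def by (intro span_scale span_diff)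
    then have "R * ((1 + \<alpha>) / 2) \<le> R * norm (u - (1 / R) *\<^sub>R (p - x))"
      using u R by (intro mult_left_mono) auto
    also have "\<dots> = norm (R *\<^sub>R (u - (1 / R) *\<^sub>R (p - x)))" using R by simp
    also have "R *\<^sub>R (u - (1 / R) *\<^sub>R (p - x)) = (x + R *\<^sub>R u - (p + q)) + q"
      using R by (simp add: algebra_simps)
    also have "norm \<dots> < \<alpha> * R + \<epsilon>"
      using norm_triangle_ineq[of "x + R *\<^sub>R u - (p + q)" q] pq by (simp add: dist_norm)
    also have "\<dots> = R * ((1 + \<alpha>) / 2)" by (simp add: \<epsilon>_def field_simps)
    finally show False by simp
  qed
  then show "\<exists>y. norm (x - y) = R \<and> ball y (\<alpha> * R) \<inter> convex hull K = {}"
    using R u by (intro exI[of _ "x + R *\<^sub>R u"]) auto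
qed

lemma strongly_porous_imp_nowhere_dense:
  fixes M :: "'a::real_normed_vector set"
  assumes "strongly_porous M"
  shows "nowhere_dense M"
proof (rule ccontr)
  assume "\<not> nowhere_dense M"
  then obtain x e where e: "e > 0" "ball x e \<subseteq> closure M"
    unfolding nowhere_dense_def by (metis all_not_in_conv mem_interior)
  \<comment> \<open>Half of the radius keeps \<open>y\<close> inside \<open>ball x e\<close>, hence
    in the closure of \<open>M\<close>, while the porosity ball around \<open>y\<close> misses
    \<open>M\<close>.\<close>
  obtain y where y: "norm (x - y) = e / 2" "ball y (1 / 2 * (e / 2)) \<inter> M = {}"
    using assms e(1) unfolding strongly_porous_def
    by (metis greaterThanLessThan_iff half_gt_zero half_gt_zero_iff less_numeral_extra(1) field_sum_of_halves less_add_same_cancel1)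
  have "y \<in> closure M" using e y(1) by (auto simp: dist_norm)
  then obtain z where "z \<in> M" "dist z y < 1 / 2 * (e / 2)"
    using e(1) unfolding closure_approachable by (metis half_gt_zero mult_pos_pos zero_less_divide_1_iff zero_less_numeral)
  then show False using y(2) by (auto simp: dist_commute)
qed

lemma compact_imp_c_porous:
  fixes K :: "'a::real_normed_vector set"
  assumes "\<not> (\<exists>B::'a set. finite B \<and> span B = UNIV)" and "compact K"
  shows "c_porous K"
  unfolding c_porous_def
  using strongly_porous_convex_hull_compact[OF assms] by (rule strongly_porous_imp_nowhere_dense)

lemma strongly_porous_if_locally_compact:
  fixes M :: "'a::real_normed_vector set"
  assumes infinite_dim: "\<not> (\<exists>B::'a set. finite B \<and> span B = UNIV)"
    and M: "\<And>r. compact (M \<inter> cball 0 r)"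
  shows "strongly_porous M"
  unfolding strongly_porous_def
proof (intro allI impI ballI)
  fix R \<alpha> :: real and x :: 'a assume R: "R > 0" and \<alpha>: "\<alpha> \<in> {0<..<1}"
  \<comment> \<open>Points of \<open>ball y (\<alpha> * R)\<close> have norm below
    \<open>norm x + R + \<alpha> * R\<close>, so only this compact piece of \<open>M\<close> can
    meet the ball.\<close>
  define K where "K = M \<inter> cball 0 (norm x + 2 * R)"
  have "strongly_porous (convex hull K)"
    using strongly_porous_convex_hull_compact[OF infinite_dim M] by (simp add: K_def)
  then obtain y where y: "norm (x - y) = R" "ball y (\<alpha> * R) \<inter> convex hull K = {}"
    unfolding strongly_porous_def using R \<alpha> by blast
  have "ball y (\<alpha> * R) \<subseteq> cball 0 (norm x + 2 * R)"
  proof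
    fix z assume "z \<in> ball y (\<alpha> * R)"
    moreover have "\<alpha> * R \<le> R" using R \<alpha> by simp
    moreover have "norm z \<le> norm x + norm (x - y) + norm (y - z)"
      by norm
    ultimately show "z \<in> cball 0 (norm x + 2 * R)" using y(1) by (simp add: dist_norm)
  qed
  then have "ball y (\<alpha> * R) \<inter> M = {}"
    using y(2) hull_subset[of K convex] by (auto simp: K_def)
  then show "\<exists>y. norm (x - y) = R \<and> ball y (\<alpha> * R) \<inter> M = {}" using y(1) by blast
qed

section \<open>Matkowski contractions: continuity, growth and invariant balls\<close>

text \<open>The constant is \<open>\<phi> D\<close>: were it at least \<open>D\<close>, monotonicity
  would keep all iterates at \<open>D\<close> above \<open>D\<close>, against their convergence to
  0. This trades \<open>\<phi>\<close> for one uniform bound at each scale.\<close>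

lemma matkowski_contraction_modulus:
  assumes "matkowski_contraction h" and "D > 0"
  obtains c where "c < D" "\<And>x y. dist x y \<le> D \<Longrightarrow> dist (h x) (h y) \<le> c"
proof -
  obtain \<phi> :: "real \<Rightarrow> real" where mono: "mono_on {0..} \<phi>"
    and lim: "\<And>t. t \<ge> 0 \<Longrightarrow> (\<lambda>n. (\<phi> ^^ n) t) \<longlonglongrightarrow> 0"
    and h: "\<And>x y. dist (h x) (h y) \<le> \<phi> (dist x y)"
    using assms(1) unfolding matkowski_contraction_def by blast
  have "\<phi> D < D"
  proof (rule ccontr)
    assume "\<not> \<phi> D < D"
    then have D: "D \<le> \<phi> D" by simp
    have "D \<le> (\<phi> ^^ n) D" for n
    proof (induction n)
      case (Suc n)
      then have "\<phi> D \<le> \<phi> ((\<phi> ^^ n) D)" using mono_onD[OF mono] assms(2) by simp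
      then show ?case using D by simp
    qed simp
    then have "D \<le> 0" using lim[of D] assms(2) by (intro LIMSEQ_le_const) auto
    then show False using assms(2) by simp
  qed
  moreover have "dist (h x) (h y) \<le> \<phi> D" if "dist x y \<le> D" for x y
    using h[of x y] mono_onD[OF mono, of "dist x y" D] that assms(2) by simp
  ultimately show thesis using that by blast
qed

lemma matkowski_contraction_less:
  assumes "matkowski_contraction h" and "x \<noteq> y"
  shows "dist (h x) (h y) < dist x y"
proof -
  have "dist x y > 0" using assms(2) by simp
  then obtain c where "c < dist x y" "\<And>u v. dist u v \<le> dist x y \<Longrightarrow> dist (h u) (h v) \<le> c"
    using matkowski_contraction_modulus[OF assms(1)] by blast
  then show ?thesis by (meson order_le_less_trans order_refl)
qed

lemma matkowski_contraction_continuous: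
  assumes "matkowski_contraction h"
  shows "continuous_on S h"
proof -
  have "dist (h x) (h y) \<le> dist x y" for x y
    using matkowski_contraction_less[OF assms, of x y] by (cases "x = y") auto
  then show ?thesis unfolding continuous_on_iff by (meson order_le_less_trans)
qed

lemma matkowski_contraction_translate:
  fixes g :: "'a::real_normed_vector \<Rightarrow> 'a"
  assumes "matkowski_contraction g"
  shows "matkowski_contraction (\<lambda>x. g x + w)"
  using assms by (simp add: matkowski_contraction_def)

text \<open>Subdividing the segment from the origin makes the Lipschitz constant at unit scale,
  which is less than 1, govern the growth at infinity.\<close>

lemma matkowski_contraction_linear_growth:
  fixes h :: "'a::real_normed_vector \<Rightarrow> 'a"
  assumes "matkowski_contraction h"
  obtains c C where "c < 1" "\<And>x. norm (h x) \<le> c * norm x + C"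
proof -
  obtain c where c: "c < 1" "\<And>x y. dist x y \<le> 1 \<Longrightarrow> dist (h x) (h y) \<le> c"
    using matkowski_contraction_modulus[OF assms, of 1] by auto
  have c0: "c \<ge> 0" using c(2)[of 0 0] by simp
  have step: "norm (h x - h 0) \<le> real n * c" if "norm x \<le> real n" for n x
    using that
  proof (induction n arbitrary: x)
    case (Suc n)
    \<comment> \<open>This point lies \<open>n / (n + 1)\<close> of the way from the origin to
      \<open>x\<close>, so the remaining piece has length at most 1 and costs at most
      \<open>c\<close>.\<close>
    define y where "y = (real n / real (Suc n)) *\<^sub>R x"
    have "norm y = real n * (norm x / real (Suc n))" by (simp add: y_def)
    also have "\<dots> \<le> real n * 1"
      using Suc.prems by (intro mult_left_mono) (simp_all add: field_simps)
    finally have y: "norm y \<le> real n" by simp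
    have "x - y = (1 / real (Suc n)) *\<^sub>R x"
      unfolding y_def by (subst scaleR_left.diff[symmetric, of 1, simplified]) (simp add: field_simps)
    then have "dist x y = norm x / real (Suc n)" by (simp add: dist_norm)
    then have "dist x y \<le> 1" using Suc.prems by (simp add: divide_le_eq_1 del: of_nat_Suc)
    then have "norm (h x - h y) \<le> c" using c(2) by (simp add: dist_norm)
    moreover have "norm (h x - h 0) \<le> norm (h x - h y) + norm (h y - h 0)" by norm
    ultimately show ?case using Suc.IH[OF y] by (simp add: algebra_simps)
  qed (simp add: c0)
  have "norm (h x) \<le> c * norm x + (c + norm (h 0))" for x
  proof -
    \<comment> \<open>Rounding up adds at most one unit piece, whose cost \<open>c\<close> goes into
      the additive constant.\<close>
    define n where "n = nat \<lceil>norm x\<rceil>"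
    have n: "norm x \<le> real n" "real n \<le> norm x + 1" using norm_ge_zero[of x] unfolding n_def by linarith+
    have "norm (h x) \<le> norm (h x - h 0) + norm (h 0)" by norm
    also have "\<dots> \<le> real n * c + norm (h 0)" using step[OF n(1)] by simp
    also have "\<dots> \<le> (norm x + 1) * c + norm (h 0)" using n(2) c0 by (simp add: mult_right_mono)
    finally show ?thesis by (simp add: algebra_simps)
  qed
  then show thesis using that c(1) by blast
qed

text \<open>The margin \<open>\<rho>\<close> leaves room for a translation of norm at most
  \<open>\<rho>\<close>. Having every \<open>r\<close> above \<open>r0\<close> lets two maps share a
  radius.\<close>

lemma matkowski_contraction_invariant_ball:
  fixes h :: "'a::real_normed_vector \<Rightarrow> 'a"
  assumes "matkowski_contraction h"
  obtains r0 where "\<And>r x. r0 \<le> r \<Longrightarrow> norm x \<le> r \<Longrightarrow> norm (h x) + \<rho> \<le> r"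
proof -
  obtain c C where c: "c < 1" "\<And>x. norm (h x) \<le> c * norm x + C"
    using matkowski_contraction_linear_growth[OF assms] by blast
  define c' where "c' = max c 0"
  have c': "0 \<le> c'" "c' < 1" using c(1) by (auto simp: c'_def)
  have h: "norm (h x) \<le> c' * norm x + C" for x
    using c(2)[of x] mult_right_mono[of c c' "norm x"] by (simp add: c'_def)
  \<comment> \<open>The threshold is the solution of \<open>c' * r + C + \<rho> = r\<close>; cutting
    \<open>c\<close> off at 0 makes \<open>c' * norm x\<close> monotone in the norm.\<close>
  have "norm (h x) + \<rho> \<le> r" if r: "(C + \<rho>) / (1 - c') \<le> r" and x: "norm x \<le> r" for r x
  proof -
    have "C + \<rho> \<le> r * (1 - c')" using r c' by (simp add: pos_divide_le_eq)
    moreover have "c' * norm x \<le> c' * r" using x c' by (intro mult_left_mono) auto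
    ultimately show ?thesis using h[of x] by (simp add: algebra_simps)
  qed
  then show thesis using that by blast
qed

section \<open>Uniqueness and existence of attractors\<close>

text \<open>Take a point \<open>a = h a'\<close> of \<open>A\<close> farthest from \<open>B\<close>
  and a point \<open>b\<close> of \<open>B\<close> nearest to \<open>a'\<close>. If the distance
  were positive, \<open>h b\<close> would be a point of \<open>B\<close> strictly closer to
  \<open>a\<close> than the maximum allows. Applied in both directions, this gives
  uniqueness.\<close>

lemma self_covering_subset_invariant:
  fixes A B :: "'a::metric_space set"
  assumes F: "\<And>h. h \<in> F \<Longrightarrow> matkowski_contraction h"
    and A: "compact A" "A \<subseteq> (\<Union>h\<in>F. h ` A)"
    and B: "compact B" "B \<noteq> {}" "(\<Union>h\<in>F. h ` B) \<subseteq> B"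
  shows "A \<subseteq> B"
proof (cases "A = {}")
  case False
  have cont: "continuous_on A (\<lambda>x. infdist x B)" by (intro continuous_intros)
  obtain a where a: "a \<in> A" "\<And>x. x \<in> A \<Longrightarrow> infdist x B \<le> infdist a B"
    using continuous_attains_sup[OF A(1) False cont] by blast
  have "infdist a B = 0"
  proof (rule ccontr)
    assume "infdist a B \<noteq> 0"
    then have D: "infdist a B > 0" using infdist_nonneg[of a B] by linarith
    obtain h a' where h: "h \<in> F" "a' \<in> A" "a = h a'" using a(1) A(2) by blast
    have contd: "continuous_on B (dist a')" by (intro continuous_intros)
    obtain b where b: "b \<in> B" "\<And>x. x \<in> B \<Longrightarrow> dist a' b \<le> dist a' x"
      using continuous_attains_inf[OF B(1,2) contd] by blast
    have "dist a' b \<le> infdist a' B"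
      unfolding infdist_def using B(2) b(2) by (auto intro: cINF_greatest)
    then have le: "dist a' b \<le> infdist a B" using a(2)[OF h(2)] by simp
    have "h b \<in> B" using B(3) h(1) b(1) by blast
    then have "infdist a B \<le> dist (h a') (h b)" unfolding h(3) by (rule infdist_le)
    also have "\<dots> < infdist a B"
      using matkowski_contraction_less[OF F[OF h(1)], of a' b] le D by (cases "a' = b") auto
    finally show False by simp
  qed
  then have "infdist x B = 0" if "x \<in> A" for x
    using a(2)[OF that] infdist_nonneg[of x B] by linarith
  then show ?thesis
    using in_closed_iff_infdist_zero[OF compact_imp_closed[OF B(1)] B(2)] by blast
qed simp

lemma is_attractor_unique:
  assumes "\<And>h. h \<in> F \<Longrightarrow> matkowski_contraction h" and "is_attractor F A" "is_attractor F B"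
  shows "A = B"
proof
  have A: "compact A" "A \<noteq> {}" "A = (\<Union>h\<in>F. h ` A)"
    and B: "compact B" "B \<noteq> {}" "B = (\<Union>h\<in>F. h ` B)"
    using assms(2,3) unfolding is_attractor_def by blast+
  show "A \<subseteq> B"
    using self_covering_subset_invariant[OF assms(1) A(1) equalityD1[OF A(3)] B(1,2) equalityD2[OF B(3)]] .
  show "B \<subseteq> A"
    using self_covering_subset_invariant[OF assms(1) B(1) equalityD1[OF B(3)] A(1,2) equalityD2[OF A(3)]] .
qed

lemma decreasing_compact_nonempty:
  fixes K :: "nat \<Rightarrow> 'a::t2_space set"
  assumes K: "\<And>n. compact (K n)" "\<And>n. K n \<noteq> {}" and dec: "decseq K"
  shows "\<Inter>(range K) \<noteq> {}"
proof -
  have "K 0 \<inter> (\<Inter>n\<in>UNIV. K n) \<noteq> {}"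
  proof (rule compact_imp_fip_image[OF K(1)])
    show "closed (K n)" for n using K(1) by (rule compact_imp_closed)
    fix I :: "nat set" assume I: "finite I"
    \<comment> \<open>In a decreasing family a finite intersection contains the member of largest
      index; inserting 0 covers \<open>K 0\<close> and keeps \<open>Max\<close> defined when
      \<open>I\<close> is empty.\<close>
    have "K (Max (insert 0 I)) \<subseteq> K i" if "i \<in> insert 0 I" for i
      using I that by (intro decseqD[OF dec] Max_ge) auto
    then show "K 0 \<inter> (\<Inter>i\<in>I. K i) \<noteq> {}" using K(2)[of "Max (insert 0 I)"] by blast
  qed
  then show ?thesis by auto
qed

text \<open>The Hutchinson operator \<open>T\<close> maps \<open>K\<close> into itself, so its
  iterates decrease to a nonempty compact set, and compactness makes this set a fixed point.\<close>

lemma ex_attractor_in_invariant_compact: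
  fixes K :: "'a::t2_space set"
  assumes F: "finite F" "F \<noteq> {}" "\<And>h. h \<in> F \<Longrightarrow> continuous_on UNIV h"
    and K: "compact K" "K \<noteq> {}" "(\<Union>h\<in>F. h ` K) \<subseteq> K"
  shows "\<exists>A\<subseteq>K. is_attractor F A"
proof -
  define T where "T S = (\<Union>h\<in>F. h ` S)" for S
  define L where "L n = (T ^^ n) K" for n
  have T_mono: "S \<subseteq> S' \<Longrightarrow> T S \<subseteq> T S'" for S S' by (auto simp: T_def)
  have L0: "L 0 = K" and L_Suc: "L (Suc n) = T (L n)" for n by (simp_all add: L_def)
  have L_compact: "compact (L n)" for n
  proof (induction n)
    case (Suc n)
    then show ?case unfolding L_Suc T_def
      using F by (intro compact_UN compact_continuous_image continuous_on_subset[OF F(3)]) auto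
  qed (simp add: L0 K)
  have L_ne: "L n \<noteq> {}" for n
    by (induction n) (use F(2) K(2) in \<open>auto simp: L0 L_Suc T_def\<close>)
  have L_dec: "decseq L"
  proof (rule decseq_SucI)
    show "L (Suc n) \<subseteq> L n" for n
    proof (induction n)
      case 0
      show ?case unfolding L_Suc L0 using K(3) by (simp add: T_def)
    next
      case (Suc n)
      show ?case unfolding L_Suc[of "Suc n"] by (subst (2) L_Suc) (rule T_mono[OF Suc])
    qed
  qed
  define A where "A = \<Inter>(range L)"
  have A: "A \<noteq> {}" "A \<subseteq> K" unfolding A_def using decreasing_compact_nonempty[OF L_compact L_ne L_dec] L0 by auto
  have "closed A" unfolding A_def using L_compact by (intro closed_INT) (auto intro: compact_imp_closed)
  then have "compact A" using compact_Int_closed[OF K(1)] A(2) by (metis inf.absorb2)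
  have TA: "T A \<subseteq> A"
  proof -
    have "T A \<subseteq> L (Suc n)" for n unfolding L_Suc A_def by (rule T_mono) auto
    moreover have "L (Suc n) \<subseteq> L n" for n using L_dec by (simp add: decseq_Suc_iff)
    ultimately show ?thesis unfolding A_def by blast
  qed
  moreover have "A \<subseteq> T A"
  proof
    fix a assume a: "a \<in> A"
    \<comment> \<open>The preimages of \<open>a\<close> under the maps of \<open>F\<close> form a
      closed set that meets every \<open>L n\<close>; Cantor's intersection argument yields one
      preimage lying in all of them.\<close>
    define P where "P = (\<Union>h\<in>F. h -` {a})"
    have "closed P" unfolding P_def using F by (intro closed_UN) (auto intro!: closed_vimage)
    define M where "M n = L n \<inter> P" for n
    have "M n \<noteq> {}" for n
    proof -
      have "a \<in> L (Suc n)" using a by (simp add: A_def)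
      then show ?thesis by (auto simp: L_Suc T_def M_def P_def)
    qed
    moreover have "compact (M n)" for n unfolding M_def using L_compact \<open>closed P\<close> by (rule compact_Int_closed)
    moreover have "decseq M" using L_dec unfolding M_def decseq_def by blast
    ultimately have "\<Inter>(range M) \<noteq> {}" by (intro decreasing_compact_nonempty)
    then obtain b where "b \<in> A" "b \<in> P" by (auto simp: M_def A_def)
    then show "a \<in> T A" by (auto simp: T_def P_def)
  qed
  ultimately have "A = (\<Union>h\<in>F. h ` A)" by (auto simp: T_def)
  then show ?thesis using A \<open>compact A\<close> unfolding is_attractor_def by blast
qed

section \<open>Attractors of \<open>f\<close> together with the translates of
  \<open>g\<close>\<close>

locale compact_matkowski_pair =
  fixes f g :: "'a::banach \<Rightarrow> 'a"
  assumes f_contr: "matkowski_contraction f" and g_contr: "matkowski_contraction g"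
    and f_compact: "compact_map f" and g_compact: "compact_map g"
begin

definition ifs :: "'a \<Rightarrow> ('a \<Rightarrow> 'a) set" where
  "ifs w = {f, \<lambda>x. g x + w}"

lemma ifs_contr: "h \<in> ifs w \<Longrightarrow> matkowski_contraction h"
  using f_contr matkowski_contraction_translate[OF g_contr] by (auto simp: ifs_def)

lemma ifs_image: "(\<Union>h\<in>ifs w. h ` A) = f ` A \<union> (\<lambda>x. g x + w) ` A"
  by (auto simp: ifs_def)

lemma ex_invariant_ball:
  obtains r where "r \<ge> 0"
    "\<And>x w. norm x \<le> r \<Longrightarrow> norm w \<le> \<rho> \<Longrightarrow> norm (f x) \<le> r \<and> norm (g x + w) \<le> r"
proof -
  obtain rf where rf: "\<And>r x. rf \<le> r \<Longrightarrow> norm x \<le> r \<Longrightarrow> norm (f x) + 0 \<le> r"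
    using matkowski_contraction_invariant_ball[OF f_contr] by blast
  obtain rg where rg: "\<And>r x. rg \<le> r \<Longrightarrow> norm x \<le> r \<Longrightarrow> norm (g x) + \<rho> \<le> r"
    using matkowski_contraction_invariant_ball[OF g_contr] by blast
  define r where "r = Max {rf, rg, 0}"
  have r: "rf \<le> r" "rg \<le> r" "0 \<le> r" by (simp_all add: r_def)
  show thesis
  proof (rule that[OF r(3)])
    fix x w :: 'a assume x: "norm x \<le> r" and w: "norm w \<le> \<rho>"
    have "norm (g x + w) \<le> norm (g x) + norm w" by norm
    then show "norm (f x) \<le> r \<and> norm (g x + w) \<le> r"
      using rf[OF r(1) x] rg[OF r(2) x] w by simp
  qed
qed

lemma ex_attractor_in_ball:
  assumes "r \<ge> 0" and "\<And>x. norm x \<le> r \<Longrightarrow> norm (f x) \<le> r \<and> norm (g x + w) \<le> r"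
  shows "\<exists>A\<subseteq>cball 0 r. is_attractor (ifs w) A"
proof -
  let ?B = "cball 0 r :: 'a set"
  let ?g = "\<lambda>x. g x + w"
  \<comment> \<open>The ball is invariant but not compact; the closures of its images are compact,
    and they stay in the ball, hence are mapped into themselves.\<close>
  define K where "K = closure (f ` ?B) \<union> closure (?g ` ?B)"
  have "?g ` ?B = (+) w ` g ` ?B" by (auto simp: image_image add.commute)
  then have "closure (?g ` ?B) = (+) w ` closure (g ` ?B)" by (simp add: closure_translation)
  then have "compact K"
    unfolding K_def using f_compact g_compact
    by (auto simp: compact_map_def intro!: compact_Un compact_translation)
  have KB: "K \<subseteq> ?B" unfolding K_def using assms(2) by (intro Un_least closure_minimal) auto
  have "?B \<noteq> {}" using assms(1) by auto
  then have "K \<noteq> {}" by (auto simp: K_def)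
  have "f ` ?B \<subseteq> K" unfolding K_def by (rule le_supI1[OF closure_subset])
  then have fK: "f ` K \<subseteq> K" by (rule order_trans[OF image_mono[OF KB]])
  have "?g ` ?B \<subseteq> K" unfolding K_def by (rule le_supI2[OF closure_subset])
  then have "?g ` K \<subseteq> K" by (rule order_trans[OF image_mono[OF KB]])
  with fK have "(\<Union>h\<in>ifs w. h ` K) \<subseteq> K" unfolding ifs_image by (rule Un_least)
  moreover have "finite (ifs w)" "ifs w \<noteq> {}" by (simp_all add: ifs_def)
  ultimately have "\<exists>A\<subseteq>K. is_attractor (ifs w) A"
    using \<open>compact K\<close> \<open>K \<noteq> {}\<close> matkowski_contraction_continuous[OF ifs_contr]
    by (intro ex_attractor_in_invariant_compact)
  then show ?thesis using KB by (meson order_trans)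
qed

definition attr :: "'a \<Rightarrow> 'a set" where
  "attr w = attractor (ifs w)"

lemma attr_eqI:
  assumes "is_attractor (ifs w) A"
  shows "attr w = A"
  unfolding attr_def attractor_def
proof (rule the_equality)
  show "B = A" if "is_attractor (ifs w) B" for B
    by (rule is_attractor_unique[OF _ that assms]) (rule ifs_contr)
qed (fact assms)

lemma attr_is_attractor: "is_attractor (ifs w) (attr w)"
proof -
  obtain r where "r \<ge> 0" "\<And>x v. norm x \<le> r \<Longrightarrow> norm v \<le> norm w \<Longrightarrow> norm (f x) \<le> r \<and> norm (g x + v) \<le> r"
    using ex_invariant_ball by blast
  then obtain A where "is_attractor (ifs w) A" using ex_attractor_in_ball[of r w] by blast
  then show ?thesis using attr_eqI by simp
qed

lemma attr_nonempty: "attr w \<noteq> {}"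
  using attr_is_attractor[of w] unfolding is_attractor_def by (elim conjE)

lemma compact_attr: "compact (attr w)"
  using attr_is_attractor[of w] unfolding is_attractor_def by (elim conjE)

lemma attr_eq: "attr w = f ` attr w \<union> (\<lambda>x. g x + w) ` attr w"
  using attr_is_attractor[of w] unfolding is_attractor_def ifs_image by (elim conjE)

lemma attr_uniformly_bounded:
  obtains r where "\<And>w. norm w \<le> \<rho> \<Longrightarrow> attr w \<subseteq> cball 0 r"
proof -
  obtain r where r: "r \<ge> 0" "\<And>x w. norm x \<le> r \<Longrightarrow> norm w \<le> \<rho> \<Longrightarrow> norm (f x) \<le> r \<and> norm (g x + w) \<le> r"
    using ex_invariant_ball by blast
  have "attr w \<subseteq> cball 0 r" if "norm w \<le> \<rho>" for w
    using ex_attractor_in_ball[OF r(1), of w] r(2) that attr_eqI by blast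
  then show thesis using that by blast
qed

lemma locus_eq: "connectedness_locus f g = {w. connected (attr w)}"
  by (simp add: connectedness_locus_def attr_def ifs_def)

section \<open>Limits of attractors and closedness of the connectedness locus\<close>

text \<open>The graph of the set-valued map \<open>attr\<close> over \<open>S\<close>. The fibre of
  its closure over \<open>w\<close> holds every limit of points of attractors whose parameters lie
  in \<open>S\<close> and tend to \<open>w\<close>.\<close>

definition attr_graph :: "'a set \<Rightarrow> ('a \<times> 'a) set" where
  "attr_graph S = (SIGMA v:S. attr v)"

text \<open>All \<open>b n\<close> lie in one compact set: a common ball holds the attractors, its
  images under \<open>f\<close> and \<open>g\<close> are relatively compact, and the translations
  \<open>v n\<close> together with their limit form a compact set.\<close>

lemma attr_convergent_subseq:
  assumes v: "v \<longlonglongrightarrow> w" and b: "\<And>n. b n \<in> attr (v n)"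
  obtains r l where "strict_mono (r :: nat \<Rightarrow> nat)" "(b \<circ> r) \<longlonglongrightarrow> l"
proof -
  have "bounded (range v)" using convergent_imp_bounded[OF v] .
  then obtain \<rho> where \<rho>: "\<And>n. norm (v n) \<le> \<rho>" unfolding bounded_iff by blast
  obtain R where R: "\<And>w. norm w \<le> \<rho> \<Longrightarrow> attr w \<subseteq> cball 0 R" using attr_uniformly_bounded by blast
  define Cf Cg where "Cf = closure (f ` cball 0 R)" and "Cg = closure (g ` cball 0 R)"
  have comp: "compact Cf" "compact Cg"
    using f_compact g_compact by (auto simp: Cf_def Cg_def compact_map_def)
  have "compactin euclidean (insert w (range v))"
    by (rule compactin_sequence_with_limit) (use v in auto)
  then have "compact (insert w (range v))" by simp
  then have "compact (Cf \<union> {x + y |x y. x \<in> Cg \<and> y \<in> insert w (range v)})" (is "compact ?K")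
    using comp by (intro compact_Un compact_sums)
  moreover have "\<forall>n. b n \<in> ?K"
  proof
    fix n
    have sub: "attr (v n) \<subseteq> cball 0 R" using R \<rho> by blast
    have "b n \<in> f ` attr (v n) \<or> b n \<in> (\<lambda>x. g x + v n) ` attr (v n)"
      using b[of n] attr_eq[of "v n"] by blast
    then show "b n \<in> ?K"
    proof
      assume "b n \<in> f ` attr (v n)"
      then have "b n \<in> Cf" unfolding Cf_def using sub closure_subset by blast
      then show ?thesis by blast
    next
      assume "b n \<in> (\<lambda>x. g x + v n) ` attr (v n)"
      then obtain x where "x \<in> attr (v n)" "b n = g x + v n" by blast
      moreover from this have "g x \<in> Cg" unfolding Cg_def using sub closure_subset by blast
      ultimately show ?thesis by blast
    qed
  qed
  ultimately obtain l r where "strict_mono r" "(b \<circ> r) \<longlonglongrightarrow> l" unfolding compact_def by blast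
  then show thesis using that by blast
qed

lemma f_tendsto: "x \<longlonglongrightarrow> a \<Longrightarrow> (\<lambda>n. f (x n)) \<longlonglongrightarrow> f a"
  by (rule continuous_on_tendsto_compose[OF matkowski_contraction_continuous[OF f_contr, of UNIV]]) simp_all

lemma g_tendsto: "x \<longlonglongrightarrow> a \<Longrightarrow> (\<lambda>n. g (x n)) \<longlonglongrightarrow> g a"
  by (rule continuous_on_tendsto_compose[OF matkowski_contraction_continuous[OF g_contr, of UNIV]]) simp_all

text \<open>The fibre of the closed graph is invariant under the limiting system, which the
  uniqueness of the attractor then identifies.\<close>

lemma closure_attr_graph_fibre:
  assumes "w \<in> closure S"
  shows "{x. (w, x) \<in> closure (attr_graph S)} = attr w"
proof -
  define L where "L = {x. (w, x) \<in> closure (attr_graph S)}"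
  have LI: "l \<in> L" if "v \<longlonglongrightarrow> w" "\<And>n. v n \<in> S" "\<And>n. b n \<in> attr (v n)" "b \<longlonglongrightarrow> l" for v b l
    using that unfolding L_def closure_sequential mem_Collect_eq
    by (intro exI[of _ "\<lambda>n. (v n, b n)"]) (auto simp: attr_graph_def intro: tendsto_Pair)
  have LE: "\<exists>v b. v \<longlonglongrightarrow> w \<and> (\<forall>n. v n \<in> S) \<and> (\<forall>n. b n \<in> attr (v n)) \<and> b \<longlonglongrightarrow> l" if "l \<in> L" for l
  proof -
    have "\<exists>z. (\<forall>n. z n \<in> attr_graph S) \<and> z \<longlonglongrightarrow> (w, l)"
      using that by (simp add: L_def closure_sequential)
    then obtain z where z: "\<forall>n. z n \<in> attr_graph S" "z \<longlonglongrightarrow> (w, l)" by blast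
    have "fst (z n) \<in> S \<and> snd (z n) \<in> attr (fst (z n))" for n
      using z(1)[rule_format, of n] by (auto simp: attr_graph_def)
    moreover have "(\<lambda>n. fst (z n)) \<longlonglongrightarrow> w" "(\<lambda>n. snd (z n)) \<longlonglongrightarrow> l"
      using tendsto_fst[OF z(2)] tendsto_snd[OF z(2)] by simp_all
    ultimately show ?thesis
      by (intro exI[of _ "\<lambda>n. fst (z n)"] exI[of _ "\<lambda>n. snd (z n)"]) simp
  qed
  have "L \<noteq> {}"
  proof -
    obtain v where v: "\<And>n. v n \<in> S" "v \<longlonglongrightarrow> w" using assms unfolding closure_sequential by blast
    have "\<exists>b. \<forall>n. b n \<in> attr (v n)" using attr_nonempty by (intro choice) blast
    then obtain b where b: "\<And>n. b n \<in> attr (v n)" by blast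
    obtain r l where "strict_mono r" "(b \<circ> r) \<longlonglongrightarrow> l" using attr_convergent_subseq[OF v(2) b] by blast
    then have "l \<in> L"
      using LI[of "v \<circ> r" "b \<circ> r" l] v b LIMSEQ_subseq_LIMSEQ[OF v(2)] by auto
    then show ?thesis by blast
  qed
  have sub: "(\<Union>h\<in>ifs w. h ` L) \<subseteq> L"
  proof -
    have "f l \<in> L \<and> g l + w \<in> L" if l: "l \<in> L" for l
    proof -
      obtain v b where vb: "v \<longlonglongrightarrow> w" "\<And>n. v n \<in> S" "\<And>n. b n \<in> attr (v n)" "b \<longlonglongrightarrow> l" using LE[OF l] by blast
      have "f (b n) \<in> attr (v n)" "g (b n) + v n \<in> attr (v n)" for n
        using attr_eq[of "v n"] vb(3)[of n] by blast+
      then show ?thesis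
        using LI[OF vb(1,2) _ f_tendsto[OF vb(4)]]
          LI[OF vb(1,2) _ tendsto_add[OF g_tendsto[OF vb(4)] vb(1)]] by blast
    qed
    then show ?thesis unfolding ifs_image by blast
  qed
  have sup: "L \<subseteq> (\<Union>h\<in>ifs w. h ` L)"
  proof
    fix l assume "l \<in> L"
    then obtain v a where va: "v \<longlonglongrightarrow> w" "\<And>n. v n \<in> S" "\<And>n. a n \<in> attr (v n)" "a \<longlonglongrightarrow> l" using LE by blast
    have "\<forall>n. \<exists>b. b \<in> attr (v n) \<and> (a n = f b \<or> a n = g b + v n)"
      using va(3) attr_eq by blast
    then obtain b where b: "\<And>n. b n \<in> attr (v n)" "\<And>n. a n = f (b n) \<or> a n = g (b n) + v n" by metis
    obtain r m where r: "strict_mono r" and m: "(b \<circ> r) \<longlonglongrightarrow> m" using attr_convergent_subseq[OF va(1) b(1)] by blast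
    have vr: "(v \<circ> r) \<longlonglongrightarrow> w" and ar: "(a \<circ> r) \<longlonglongrightarrow> l"
      using LIMSEQ_subseq_LIMSEQ[OF _ r] va by blast+
    have "m \<in> L" using LI[OF vr _ _ m] va(2) b(1) by simp
    \<comment> \<open>Each \<open>a n\<close> is an image of \<open>b n\<close> under one of the two
      maps. The vanishing product expresses this alternative as an equation, which passes to the
      limit by continuity.\<close>
    have "(\<lambda>n. norm ((a \<circ> r) n - f ((b \<circ> r) n)) * norm ((a \<circ> r) n - (g ((b \<circ> r) n) + (v \<circ> r) n)))
        \<longlonglongrightarrow> norm (l - f m) * norm (l - (g m + w))"
      by (intro tendsto_intros f_tendsto g_tendsto m ar vr)
    moreover have "norm ((a \<circ> r) n - f ((b \<circ> r) n)) * norm ((a \<circ> r) n - (g ((b \<circ> r) n) + (v \<circ> r) n)) = 0" for n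
      using b(2)[of "r n"] by auto
    ultimately have "(\<lambda>n::nat. 0) \<longlonglongrightarrow> norm (l - f m) * norm (l - (g m + w))"
      by (simp only:)
    then have "norm (l - f m) * norm (l - (g m + w)) = 0"
      by (rule LIMSEQ_unique[OF _ tendsto_const])
    then have "l = f m \<or> l = g m + w" by auto
    then show "l \<in> (\<Union>h\<in>ifs w. h ` L)" unfolding ifs_image using \<open>m \<in> L\<close> by blast
  qed
  have "compact L"
    unfolding compact_def
  proof (intro allI impI)
    fix a :: "nat \<Rightarrow> 'a" assume a: "\<forall>n. a n \<in> L"
    \<comment> \<open>Points of \<open>L\<close> need not lie in any attractor with parameter in
      \<open>S\<close>, so \<open>a n\<close> is replaced by a point \<open>b n\<close> of such an
      attractor within \<open>1 / (n + 1)\<close>; a convergent subsequence of \<open>b\<close>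
      carries \<open>a\<close> along.\<close>
    have "\<exists>p. dist p (w, a n) < inverse (real (Suc n)) \<and> p \<in> attr_graph S" for n
    proof -
      have "(w, a n) \<in> closure (attr_graph S)" using a by (simp add: L_def)
      then show ?thesis unfolding closure_approachable by (meson inverse_positive_iff_positive of_nat_0_less_iff zero_less_Suc)
    qed
    then obtain p where p: "\<And>n. dist (p n) (w, a n) < inverse (real (Suc n))" "\<And>n. p n \<in> attr_graph S" by metis
    define v b where "v n = fst (p n)" and "b n = snd (p n)" for n
    have S: "v n \<in> S" "b n \<in> attr (v n)" for n using p(2)[of n] by (auto simp: v_def b_def attr_graph_def)
    have "dist (v n) w \<le> inverse (real (Suc n))" "dist (b n) (a n) \<le> inverse (real (Suc n))" for n
      using p(1)[of n] dist_fst_le[of "p n" "(w, a n)"] dist_snd_le[of "p n" "(w, a n)"] by (auto simp: v_def b_def)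
    then have v: "v \<longlonglongrightarrow> w" and ba: "(\<lambda>n. dist (b n) (a n)) \<longlonglongrightarrow> 0"
      by (auto intro!: metric_tendsto_imp_tendsto[OF LIMSEQ_inverse_real_of_nat] always_eventually)
    obtain r l where r: "strict_mono r" and l: "(b \<circ> r) \<longlonglongrightarrow> l" using attr_convergent_subseq[OF v S(2)] by blast
    have "l \<in> L" using LI[OF LIMSEQ_subseq_LIMSEQ[OF v r] _ _ l] S by simp
    moreover have "(a \<circ> r) \<longlonglongrightarrow> l"
      using Lim_transform2[OF l, of "a \<circ> r"] LIMSEQ_subseq_LIMSEQ[OF ba r]
      by (simp add: comp_def dist_norm tendsto_norm_zero_iff)
    ultimately show "\<exists>l\<in>L. \<exists>r. strict_mono r \<and> (a \<circ> r) \<longlonglongrightarrow> l" using r by blast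
  qed
  then have "is_attractor (ifs w) L" using \<open>L \<noteq> {}\<close> sub sup unfolding is_attractor_def by blast
  then show ?thesis unfolding L_def[symmetric] by (rule attr_eqI[symmetric])
qed

lemma closed_locus: "closed (connectedness_locus f g)"
proof -
  have "connected (attr w)" if w: "w \<in> closure (connectedness_locus f g)" for w
  proof (rule ccontr)
    assume "\<not> connected (attr w)"
    then obtain U V where UV: "closed U" "closed V" "U \<noteq> {}" "V \<noteq> {}" "U \<union> V = attr w" "U \<inter> V = {}"
      unfolding connected_closed_set[OF compact_imp_closed[OF compact_attr]] by blast
    obtain P Q where PQ: "open P" "open Q" "U \<subseteq> P" "V \<subseteq> Q" "P \<inter> Q = {}"
      using t4_space[OF UV(1,2,6)] by blast
    \<comment> \<open>A connected \<open>attr v\<close> inside \<open>P \<union> Q\<close> misses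
      one of the two, so these three classes cover the locus and at least one has \<open>w\<close>
      in its closure.\<close>
    define S0 where "S0 = {v. \<not> attr v \<subseteq> P \<union> Q}"
    define S1 where "S1 = {v. attr v \<inter> Q = {}}"
    define S2 where "S2 = {v. attr v \<inter> P = {}}"
    have "connectedness_locus f g \<subseteq> S0 \<union> S1 \<union> S2"
    proof
      fix v assume "v \<in> connectedness_locus f g"
      then have "connected (attr v)" by (simp add: locus_eq)
      then have "P \<inter> attr v = {} \<or> Q \<inter> attr v = {}" if "attr v \<subseteq> P \<union> Q"
        using connectedD[of "attr v" P Q] PQ that by blast
      then show "v \<in> S0 \<union> S1 \<union> S2" unfolding S0_def S1_def S2_def by blast
    qed
    then have "closure (connectedness_locus f g) \<subseteq> closure (S0 \<union> S1 \<union> S2)" by (rule closure_mono)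
    then have split: "w \<in> closure S0 \<or> w \<in> closure S1 \<or> w \<in> closure S2" using w by auto
    \<comment> \<open>The graph over \<open>S\<close> lies in the closed set
      \<open>UNIV \<times> (- O')\<close>; so does its closure, whose fibre over \<open>w\<close> is
      \<open>attr w\<close>.\<close>
    have avoid: "O' \<inter> attr w = {}"
      if "w \<in> closure S" "open O'" "\<And>v. v \<in> S \<Longrightarrow> attr v \<inter> O' = {}" for S O'
    proof -
      have "closure (attr_graph S) \<subseteq> UNIV \<times> (- O')"
        using that by (intro closure_minimal closed_Times) (auto simp: attr_graph_def)
      then show ?thesis using closure_attr_graph_fibre[OF that(1)] by blast
    qed
    have "w \<notin> closure S1"
    proof
      assume "w \<in> closure S1"
      then have "Q \<inter> attr w = {}" using PQ(2) by (rule avoid) (auto simp: S1_def)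
      then show False using PQ UV by blast
    qed
    moreover have "w \<notin> closure S2"
    proof
      assume "w \<in> closure S2"
      then have "P \<inter> attr w = {}" using PQ(1) by (rule avoid) (auto simp: S2_def)
      then show False using PQ UV by blast
    qed
    ultimately have w0: "w \<in> closure S0" using split by simp
    then obtain v where v: "\<And>n. v n \<in> S0" "v \<longlonglongrightarrow> w" unfolding closure_sequential by blast
    \<comment> \<open>The points escaping \<open>P \<union> Q\<close> subconverge to a point of
      \<open>attr w\<close> outside \<open>P \<union> Q\<close>, although \<open>attr w\<close> is
      covered by \<open>U\<close> and \<open>V\<close>.\<close>
    have "\<forall>n. \<exists>a. a \<in> attr (v n) \<and> a \<notin> P \<union> Q" using v(1) unfolding S0_def by blast
    then obtain a where a: "\<And>n. a n \<in> attr (v n)" "\<And>n. a n \<in> - (P \<union> Q)" by (metis ComplI)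
    obtain r l where r: "strict_mono r" and l: "(a \<circ> r) \<longlonglongrightarrow> l" using attr_convergent_subseq[OF v(2) a(1)] by blast
    have "(\<lambda>n. ((v \<circ> r) n, (a \<circ> r) n)) \<longlonglongrightarrow> (w, l)"
      using LIMSEQ_subseq_LIMSEQ[OF v(2) r] l by (rule tendsto_Pair)
    then have "(w, l) \<in> closure (attr_graph S0)"
      unfolding closure_sequential using v(1) a(1)
      by (intro exI[of _ "\<lambda>n. ((v \<circ> r) n, (a \<circ> r) n)"]) (auto simp: attr_graph_def)
    then have "l \<in> attr w" using closure_attr_graph_fibre[OF w0] by blast
    moreover have "l \<in> - (P \<union> Q)"
      using PQ a(2) by (intro closed_sequentially[OF _ _ l]) (auto intro: closed_Compl)
    ultimately show False using UV PQ by blast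
  qed
  then have "closure (connectedness_locus f g) \<subseteq> connectedness_locus f g"
    unfolding locus_eq by blast
  then show ?thesis by (simp only: closure_subset_eq)
qed

section \<open>Compactness of the bounded parts of the locus, and the conclusion\<close>

lemma connected_attr_overlap:
  assumes "connected (attr w)"
  obtains a b where "a \<in> attr w" "b \<in> attr w" "f a = g b + w"
proof -
  let ?g = "\<lambda>x. g x + w"
  have cl: "closed (f ` attr w)" "closed (?g ` attr w)"
    using f_contr matkowski_contraction_translate[OF g_contr]
    by (auto intro: compact_imp_closed[OF compact_continuous_image[OF _ compact_attr]]
        matkowski_contraction_continuous)
  have "f ` attr w \<inter> ?g ` attr w \<noteq> {}"
  proof
    assume "f ` attr w \<inter> ?g ` attr w = {}"
    then have "f ` attr w \<inter> attr w = {} \<or> ?g ` attr w \<inter> attr w = {}"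
      using attr_eq[of w] by (intro connected_closedD[OF assms _ _ cl]) auto
    \<comment> \<open>One of the images would be disjoint from \<open>attr w\<close>, although both
      are nonempty subsets of it.\<close>
    then show False using attr_eq[of w] attr_nonempty[of w] by blast
  qed
  then show thesis using that by blast
qed

text \<open>The overlap writes \<open>w\<close> as \<open>f a - g b\<close> with both terms in
  compact sets depending on \<open>\<rho>\<close> only; closedness of the locus turns relative
  compactness into compactness.\<close>

lemma compact_locus_cball: "compact (connectedness_locus f g \<inter> cball 0 \<rho>)"
proof -
  obtain R where R: "\<And>w. norm w \<le> \<rho> \<Longrightarrow> attr w \<subseteq> cball 0 R" using attr_uniformly_bounded by blast
  define Cf Cg where "Cf = closure (f ` cball 0 R)" and "Cg = closure (g ` cball 0 R)"
  have "compact Cf" "compact Cg"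
    using f_compact g_compact by (auto simp: Cf_def Cg_def compact_map_def)
  then have "compact {x - y |x y. x \<in> Cf \<and> y \<in> Cg}" (is "compact ?K") by (rule compact_differences)
  moreover have "closed (connectedness_locus f g \<inter> cball 0 \<rho>)" (is "closed ?M")
    using closed_locus by (intro closed_Int) auto
  ultimately have "compact (?K \<inter> ?M)" by (rule compact_Int_closed)
  moreover have "?M \<subseteq> ?K"
  proof
    fix w assume w: "w \<in> ?M"
    then obtain a b where ab: "a \<in> attr w" "b \<in> attr w" "f a = g b + w"
      using connected_attr_overlap by (auto simp: locus_eq)
    have "attr w \<subseteq> cball 0 R" using R w by simp
    then have "f a \<in> f ` cball 0 R" "g b \<in> g ` cball 0 R" using ab(1,2) by blast+
    then have "f a \<in> Cf" "g b \<in> Cg"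
      unfolding Cf_def Cg_def by (simp_all add: closure_subset[THEN subsetD])
    moreover have "w = f a - g b" using ab(3) by simp
    ultimately show "w \<in> ?K" by blast
  qed
  then have "?K \<inter> ?M = ?M" by (rule Int_absorb1)
  ultimately show ?thesis by simp
qed

end

theorem theorem2p8:
  fixes f g :: "'a::banach \<Rightarrow> 'a"
  assumes infinite_dim: "\<not> (\<exists>B::'a set. finite B \<and> span B = UNIV)"
    and "matkowski_contraction f" and "matkowski_contraction g"
    and "compact_map f" and "compact_map g"
  shows "(strongly_porous (connectedness_locus f g) \<and> nowhere_dense (connectedness_locus f g))
       \<and> (sigma_compact (connectedness_locus f g) \<and> sigma_c_porous (connectedness_locus f g))"
proof -
  interpret compact_matkowski_pair f g by (rule compact_matkowski_pair.intro[OF assms(2-5)])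
  let ?C = "connectedness_locus f g"
  \<comment> \<open>Balls of integer radius cut the locus into countably many compact pieces, which
    serve for both countable unions.\<close>
  let ?P = "range (\<lambda>n. ?C \<inter> cball 0 (real n))"
  have compact: "compact (?C \<inter> cball 0 r)" for r by (rule compact_locus_cball)
  have cover: "?C = \<Union>?P" by (auto intro: real_arch_simple)
  have "strongly_porous ?C" by (rule strongly_porous_if_locally_compact[OF infinite_dim compact])
  moreover from this have "nowhere_dense ?C" by (rule strongly_porous_imp_nowhere_dense)
  moreover have "sigma_compact ?C"
    unfolding sigma_compact_def using cover compact by (intro exI[of _ ?P] conjI) auto
  moreover have "sigma_c_porous ?C"
    unfolding sigma_c_porous_def using cover compact_imp_c_porous[OF infinite_dim compact]
    by (intro exI[of _ ?P] conjI) auto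
  ultimately show ?thesis by blast
qed

end
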